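(* The following identities hold for integers $r$, $n$, $s$, $k$ and $t$: \[(-1)^tF_k\sum_{j=0}^nF_{k+t}^jF_t^{r-j}F_{r(s+k)+s-t-kj}=F_t^{r-n}F_{k+t}^{n+1}F_{s(r+1)+k(r-n)}-F_t^{r+1}F_{(s+k)(r+1)},\] \[(-1)^tF_k\sum_{j=0}^nF_{k+t}^jF_t^{r-j}L_{r(s+k)+s-t-kj}=F_t^{r-n}F_{k+t}^{n+1}L_{s(r+1)+k(r-n)}-F_t^{r+1}L_{(s+k)(r+1)},\] \[(-1)^{rt}F_t\sum_{j=0}^n(-1)^{tj}F_k^{r-j}F_{k+t}^jF_{r(s-t)+s+k+tj}=F_k^{r-n}F_{k+t}^{n+1}F_{r(s-t)+tn+s}-(-1)^{t(r+1)}F_k^{r+1}F_{(s-t)(r+1)},\] \[(-1)^{rt}F_t\sum_{j=0}^n(-1)^{tj}F_k^{r-j}F_{k+t}^jL_{r(s-t)+s+k+tj}=F_k^{r-n}F_{k+t}^{n+1}L_{r(s-t)+tn+s}-(-1)^{t(r+1)}F_k^{r+1}L_{(s-t)(r+1)},\] \[(-1)^tF_k\sum_{j=0}^nF_{k+t}^{r-j}F_t^jF_{s(r+1)+s-t+kj}=F_{k+t}^{r+1}F_{s(r+1)}-F_{k+t}^{r-n}F_t^{n+1}F_{s(r+1)+k(n+1)}\] and \[(-1)^tF_k\sum_{j=0}^nF_{k+t}^{r-j}F_t^jL_{s(r+1)+s-t+kj}=F_{k+t}^{r+1}L_{s(r+1)}-F_{k+t}^{r-n}F_t^{n+1}L_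{s(r+1)+k(n+1)}.\]
   Context: The Fibonacci numbers $F_n$ and Lucas numbers $L_n$ are defined for all integers $n$ by $F_0=0$, $F_1=1$, $F_n=F_{n-1}+F_{n-2}$ for $n\ge 2$; $L_0=2$, $L_1=1$, $L_n=L_{n-1}+L_{n-2}$ for $n\ge 2$; and $F_{-n}=(-1)^{n-1}F_n$, $L_{-n}=(-1)^nL_n$. Here $F_m^i$ denotes the $i$-th power $(F_m)^i$.
   Formalization: Identities 3, 4: first right-hand term gets the missing factor (-1)^{t(r-n)}; identities 5, 6: summand index corrected to s(r+1)-t+kj; n >= 0 is assumed, and each identity requires n <= r or a nonzero base of the power with exponent r-n (F_t, F_k, F_{k+t} respectively). *)

theory Defs
  imports Complex_Main "HOL-Number_Theory.Fib"
begin

fun lucas :: "nat \<Rightarrow> nat" where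
  "lucas 0 = 2"
| "lucas (Suc 0) = 1"
| "lucas (Suc (Suc n)) = lucas (Suc n) + lucas n"

definition fib_int :: "int \<Rightarrow> int" where
  "fib_int n =
    (if n \<ge> 0 then int (fib (nat n))
     else (- 1) ^ (nat (- n) - 1) * int (fib (nat (- n))))"

definition lucas_int :: "int \<Rightarrow> int" where
  "lucas_int n =
    (if n \<ge> 0 then int (lucas (nat n))
     else (- 1) ^ nat (- n) * int (lucas (nat (- n))))"

lemma fib_int_simps:
  "fib_int 0 = 0" "fib_int 1 = 1"
  "n \<ge> 2 \<Longrightarrow> fib_int n = fib_int (n - 1) + fib_int (n - 2)"
  "n \<ge> 1 \<Longrightarrow> fib_int (- n) = (- 1) ^ nat (n - 1) * fib_int n"
proof -
  show "fib_int n = fib_int (n - 1) + fib_int (n - 2)" if "n \<ge> 2"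
  proof -
    obtain m where "n = int (Suc (Suc m))"
      using \<open>n \<ge> 2\<close> by (metis nat_0_le nat_le_iff le_Suc_ex numeral_2_eq_2 add_Suc nat_numeral
          add_0 order_trans zero_le_numeral nat_mono)
    then show ?thesis by (simp add: fib_int_def nat_add_distrib)
  qed
qed (simp_all add: fib_int_def nat_diff_distrib)

lemma lucas_int_simps:
  "lucas_int 0 = 2" "lucas_int 1 = 1"
  "n \<ge> 2 \<Longrightarrow> lucas_int n = lucas_int (n - 1) + lucas_int (n - 2)"
  "n \<ge> 0 \<Longrightarrow> lucas_int (- n) = (- 1) ^ nat n * lucas_int n"
proof -
  show "lucas_int n = lucas_int (n - 1) + lucas_int (n - 2)" if "n \<ge> 2"
  proof -
    obtain m where "n = int (Suc (Suc m))"
      using \<open>n \<ge> 2\<close> by (metis nat_0_le nat_le_iff le_Suc_ex numeral_2_eq_2 add_Suc nat_numeral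
          add_0 order_trans zero_le_numeral nat_mono)
    then show ?thesis by (simp add: lucas_int_def nat_add_distrib)
  qed
qed (simp_all add: lucas_int_def)

text \<open>
  The exponents \<open>r - j\<close> and \<open>r - n\<close> in the identities may be negative, so the numbers are
  embedded in the rationals and powers are taken with \<open>powi\<close>.
\<close>

abbreviation F :: "int \<Rightarrow> rat" where
  "F n \<equiv> rat_of_int (fib_int n)"

abbreviation L :: "int \<Rightarrow> rat" where
  "L n \<equiv> rat_of_int (lucas_int n)"

end

theory Submission
  imports Defs
begin

text \<open>
  Let \<open>G\<close> be any two-sided sequence with \<open>G (m + 2) = G (m + 1) + G m\<close>, for instance
  \<open>F\<close> or \<open>L\<close>. A sequence of this kind that vanishes at two consecutive indices vanishes
  everywhere, and this gives the three-term identity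
  \[ F_{k+t} G_m = F_t G_{m+k} + (-1)^t F_k G_{m-t} \]
  (lemma \<open>fib_like_three_term\<close>): both sides obey the recurrence in \<open>k\<close>, and the case \<open>k = 1\<close>
  follows in the same way from the recurrence in \<open>t\<close>.

  Each of the six sums telescopes because of this identity. It can be written as
  \<open>c * u j = a * h j - b * h (j - 1)\<close>, where \<open>h\<close> is \<open>G\<close> along an arithmetic progression;
  multiplied by \<open>a^j * b^(r - j)\<close>, the right-hand side becomes a difference of consecutive
  values of \<open>a^(j + 1) * b^(r - j) * h j\<close> (lemma \<open>weighted_telescoping\<close>). In the first and
  third pair of identities \<open>u j\<close> comes from the term \<open>G\<^bsub>m-t\<^esub>\<close> and the two pairs differ in which of the
  other two terms is \<open>h j\<close> and which is \<open>h (j - 1)\<close>; in the second pair \<open>u j\<close> comes from \<open>G\<^bsub>m+k\<^esub>\<close>.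
\<close>

section \<open>Two-sided sequences obeying the Fibonacci recurrence\<close>

text \<open>
  Sequences indexed by all integers, with rational values, that satisfy the Fibonacci recurrence
  at every index.
\<close>

definition fib_like :: "(int \<Rightarrow> rat) \<Rightarrow> bool" where
  "fib_like G \<longleftrightarrow> (\<forall>m. G (m + 2) = G (m + 1) + G m)"

lemma fib_likeD: "fib_like G \<Longrightarrow> G (m + 2) = G (m + 1) + G m"
  by (simp add: fib_like_def)

lemma fib_likeD': "fib_like G \<Longrightarrow> x = m + 2 \<Longrightarrow> y = m + 1 \<Longrightarrow> G x = G y + G m"
  by (simp add: fib_likeD)

lemma fib_like_shift:
  assumes "fib_like G"
  shows "fib_like (\<lambda>m. G (m + d))"
  unfolding fib_like_def using fib_likeD[OF assms] by (metis add.commute add.left_commute)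

lemma fib_like_diff_scaled:
  assumes "fib_like G" "fib_like H"
  shows "fib_like (\<lambda>m. a * G m - b * H m)"
  unfolding fib_like_def by (simp add: fib_likeD[OF assms(1)] fib_likeD[OF assms(2)] algebra_simps)

lemma fib_like_eq_0:
  assumes "fib_like G" "G 0 = 0" "G 1 = 0"
  shows "G m = 0"
proof -
  have "G m = 0 \<and> G (m + 1) = 0"
  proof (induction m rule: int_induct[where k = 0])
    case (step1 i)
    then show ?case using fib_likeD[OF assms(1), of i] by (simp add: add.assoc)
  next
    case (step2 i)
    then show ?case using fib_likeD[OF assms(1), of "i - 1"] by (simp add: add.commute)
  qed (use assms in simp_all)
  then show ?thesis ..
qed

lemma fib_like_eqI:
  assumes "fib_like G" "fib_like H" "G 0 = H 0" "G 1 = H 1"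
  shows "G m = H m"
  using fib_like_eq_0[OF fib_like_diff_scaled[OF assms(1,2), of 1 1]] assms(3,4) by simp

text \<open>
  The positions of the window \<open>m, m + 1, m + 2\<close> relative to \<open>0\<close>: no negative index, both signs,
  or no positive index.
\<close>

lemma int_trichotomy_cases:
  fixes m :: int
  obtains n where "m = int n" | "m = -1" | n where "m = - int n - 2"
proof -
  consider "m \<ge> 0" | "m = -1" | "- m - 2 \<ge> 0" by linarith
  then show thesis
  proof cases
    case 1
    then show ?thesis using that(1)[of "nat m"] by simp
  next
    case 2
    then show ?thesis by (rule that(2))
  next
    case 3
    then show ?thesis using that(3)[of "nat (- m - 2)"] by simp
  qed
qed

lemma F_neg: "F (- int n) = - ((-1) ^ n * of_nat (fib n))"
  by (cases n) (simp_all add: fib_int_def nat_add_distrib)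

lemma L_neg: "L (- int n) = (-1) ^ n * of_nat (lucas n)"
  by (cases n) (simp_all add: lucas_int_def nat_add_distrib)

lemma F_small: "F 0 = 0" "F 1 = 1" "F (-1) = 1"
  by (simp_all add: fib_int_def)

lemma fib_like_F: "fib_like F"
  unfolding fib_like_def
proof
  fix m :: int
  consider n where "m = int n" | "m = -1" | n where "m = - int n - 2"
    by (rule int_trichotomy_cases)
  then show "F (m + 2) = F (m + 1) + F m"
  proof cases
    case 1
    then show ?thesis by (simp add: fib_int_def nat_add_distrib)
  next
    case 2
    then show ?thesis by (simp add: fib_int_def)
  next
    case 3
    then have "m + 2 = - int n" "m + 1 = - int (n + 1)" "m = - int (n + 2)" by simp_all
    then show ?thesis by (simp only: F_neg) (simp add: algebra_simps)
  qed
qed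

lemma fib_like_L: "fib_like L"
  unfolding fib_like_def
proof
  fix m :: int
  consider n where "m = int n" | "m = -1" | n where "m = - int n - 2"
    by (rule int_trichotomy_cases)
  then show "L (m + 2) = L (m + 1) + L m"
  proof cases
    case 1
    then show ?thesis by (simp add: lucas_int_def nat_add_distrib)
  next
    case 2
    then show ?thesis by (simp add: lucas_int_def)
  next
    case 3
    then have "m + 2 = - int n" "m + 1 = - int (n + 1)" "m = - int (n + 2)" by simp_all
    then show ?thesis by (simp only: L_neg) (simp add: algebra_simps)
  qed
qed

lemma neg_one_powi_diff: "(-1::rat) powi (i - j) = (-1) powi i * (-1) powi j"
  by (simp add: power_int_diff field_simps flip: power_int_mult_distrib)

text \<open>
  The case \<open>k = 1\<close> of the three-term identity, in the reflected variable \<open>u = - t\<close>.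
  As functions of \<open>u\<close>, \<open>F (1 - u)\<close> and \<open>F (- u)\<close> obey the recurrence
  \<open>X (u + 2) = X u - X (u + 1)\<close>; the factor \<open>(-1)^u\<close> turns it back into the Fibonacci recurrence.
\<close>

lemma fib_like_reflection:
  assumes "fib_like G"
  shows "G (m + u) = (-1) powi u * (F (1 - u) * G m - F (- u) * G (m + 1))"
proof -
  have "fib_like (\<lambda>u. (-1) powi u * (F (1 - u) * G m - F (- u) * G (m + 1)))"
    unfolding fib_like_def
  proof
    fix u :: int
    have "F (1 - u) = F (- u) + F (- u - 1)" "F (- u) = F (- u - 1) + F (- u - 2)"
      by (rule fib_likeD'[OF fib_like_F]; simp)+
    moreover have "1 - (u + 2) = - u - 1" "- (u + 2) = - u - 2"
      "1 - (u + 1) = - u" "- (u + 1) = - u - 1"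
      by simp_all
    ultimately show "(-1) powi (u + 2) * (F (1 - (u + 2)) * G m - F (- (u + 2)) * G (m + 1))
      = (-1) powi (u + 1) * (F (1 - (u + 1)) * G m - F (- (u + 1)) * G (m + 1))
        + (-1) powi u * (F (1 - u) * G m - F (- u) * G (m + 1))"
      by (simp only:) (simp add: power_int_add algebra_simps)
  qed
  from fib_like_eqI[OF fib_like_shift[OF assms, of m] this, of u]
  have "G (u + m) = (-1) powi u * (F (1 - u) * G m - F (- u) * G (m + 1))"
    by (simp add: F_small add.commute[of 1 m])
  then show ?thesis by (simp only: add.commute[of m u])
qed

lemma fib_like_three_term:
  assumes "fib_like G"
  shows "(-1) powi t * F k * G (m - t) = F (k + t) * G m - F t * G (m + k)"
proof -
  have lhs: "fib_like (\<lambda>k. (-1) powi t * G (m - t) * F k - 0 * F k)"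
    by (intro fib_like_diff_scaled fib_like_F)
  have rhs: "fib_like (\<lambda>k. G m * F (k + t) - F t * G (k + m))"
    by (intro fib_like_diff_scaled fib_like_shift fib_like_F assms)
  have sq: "(-1::rat) powi t * (-1) powi (- t) = 1"
    by (simp flip: power_int_add)
  have "(-1) powi t * G (m - t) = G m * F (1 + t) - F t * G (1 + m)"
  proof -
    have "(-1) powi t * G (m - t)
      = ((-1) powi t * (-1) powi (- t)) * (F (1 + t) * G m - F t * G (m + 1))"
      using fib_like_reflection[OF assms, of m "- t"] by simp
    then show ?thesis by (simp only: sq) (simp add: algebra_simps)
  qed
  with fib_like_eqI[OF lhs rhs, of k] show ?thesis
    by (simp add: F_small algebra_simps)
qed

section \<open>Weighted telescoping sums\<close>

lemma sum_int_telescope: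
  fixes g :: "int \<Rightarrow> 'a::ab_group_add"
  assumes "n \<ge> 0"
  shows "(\<Sum>j=0..n. g j - g (j - 1)) = g n - g (-1)"
  using assms
proof (induction n rule: int_ge_induct)
  case (step i)
  then have "{0..i + 1} = insert (i + 1) {0..i}" by auto
  with step show ?case by simp
qed simp

text \<open>
  When \<open>b = 0\<close>, the hypothesis \<open>n \<le> r\<close> keeps all exponents \<open>r - j\<close> nonnegative. This is needed
  for \<open>b * b^(r - j) = b^(r - j + 1)\<close>, which fails for \<open>b = 0\<close> and \<open>r - j = -1\<close>, where the
  left-hand side is \<open>0\<close> and the right-hand side is \<open>1\<close>.
\<close>

lemma weighted_telescoping:
  fixes a b c :: "'a::field" and u h :: "int \<Rightarrow> 'a"
  assumes "n \<ge> 0" and b: "b \<noteq> 0 \<or> n \<le> r"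
    and u: "\<And>j. c * u j = a * h j - b * h (j - 1)"
  shows "c * (\<Sum>j=0..n. a powi j * b powi (r - j) * u j)
    = a powi (n + 1) * b powi (r - n) * h n - b powi (r + 1) * h (-1)"
proof -
  define g where "g j = a powi (j + 1) * b powi (r - j) * h j" for j
  have "c * (\<Sum>j=0..n. a powi j * b powi (r - j) * u j) = (\<Sum>j=0..n. g j - g (j - 1))"
    unfolding sum_distrib_left
  proof (rule sum.cong)
    fix j assume j: "j \<in> {0..n}"
    have "a powi (j + 1) = a * a powi j"
      using j by (simp add: power_int_add_1')
    moreover have "b powi (r - (j - 1)) = b * b powi (r - j)"
    proof -
      have "b powi (r - j + 1) = b * b powi (r - j)"
        using b j by (intro power_int_add_1') auto
      then show ?thesis by (simp add: algebra_simps)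
    qed
    ultimately have "g j - g (j - 1) = a powi j * b powi (r - j) * (a * h j - b * h (j - 1))"
      by (simp add: g_def algebra_simps)
    then show "c * (a powi j * b powi (r - j) * u j) = g j - g (j - 1)"
      by (simp add: u[symmetric])
  qed simp
  also have "\<dots> = g n - g (-1)"
    using \<open>n \<ge> 0\<close> by (rule sum_int_telescope)
  finally show ?thesis by (simp add: g_def)
qed

section \<open>The three sums for an arbitrary sequence\<close>

context
  fixes G :: "int \<Rightarrow> rat" and n r :: int
  assumes G: "fib_like G" and n: "n \<ge> 0"
begin

lemma fib_like_sum_descending:
  assumes "F t \<noteq> 0 \<or> n \<le> r"
  shows "(-1) powi t * F k * (\<Sum>j=0..n. F (k + t) powi j * F t powi (r - j) * G (r * (s + k) + s - t - k * j))
    = F t powi (r - n) * F (k + t) powi (n + 1) * G (s * (r + 1) + k * (r - n))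
      - F t powi (r + 1) * G ((s + k) * (r + 1))"
proof -
  define h where "h j = G (r * (s + k) + s - k * j)" for j
  have "(-1) powi t * F k * G (r * (s + k) + s - t - k * j) = F (k + t) * h j - F t * h (j - 1)" for j
    using fib_like_three_term[OF G, of t k "r * (s + k) + s - k * j"]
    by (simp add: h_def algebra_simps)
  from weighted_telescoping[where h = h, OF n assms this] show ?thesis
    by (simp add: h_def algebra_simps)
qed

lemma fib_like_sum_alternating:
  assumes "F k \<noteq> 0 \<or> n \<le> r"
  shows "(-1) powi (r * t) * F t * (\<Sum>j=0..n. (-1) powi (t * j) * F k powi (r - j) * F (k + t) powi j * G (r * (s - t) + s + k + t * j))
    = (-1) powi (t * (r - n)) * F k powi (r - n) * F (k + t) powi (n + 1) * G (r * (s - t) + t * n + s)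
      - (-1) powi (t * (r + 1)) * F k powi (r + 1) * G ((s - t) * (r + 1))"
proof -
  define h where "h j = G (r * (s - t) + s + t * j)" for j
  \<comment> \<open>The sign is absorbed into the second weight.\<close>
  define b where "b = (-1) powi t * F k"
  have b_powi: "b powi i = (-1) powi (t * i) * F k powi i" for i
    by (simp add: b_def power_int_mult_distrib power_int_mult)
  have u: "F t * G (r * (s - t) + s + k + t * j) = F (k + t) * h j - b * h (j - 1)" for j
    using fib_like_three_term[OF G, of t k "r * (s - t) + s + t * j"]
    by (simp add: h_def b_def algebra_simps)
  have "b \<noteq> 0 \<or> n \<le> r"
    using assms by (simp add: b_def)
  from weighted_telescoping[where h = h, OF n this u]
  have *: "F t * (\<Sum>j=0..n. F (k + t) powi j * b powi (r - j) * G (r * (s - t) + s + k + t * j))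
    = F (k + t) powi (n + 1) * b powi (r - n) * h n - b powi (r + 1) * h (-1)" .
  have "(-1) powi (r * t) * F t * (\<Sum>j=0..n. (-1) powi (t * j) * F k powi (r - j) * F (k + t) powi j * G (r * (s - t) + s + k + t * j))
    = F t * (\<Sum>j=0..n. F (k + t) powi j * b powi (r - j) * G (r * (s - t) + s + k + t * j))"
  proof -
    have sign: "b powi (r - j) = (-1) powi (r * t) * ((-1) powi (t * j) * F k powi (r - j))" for j
      by (simp add: b_powi right_diff_distrib neg_one_powi_diff mult.commute[of r t])
    show ?thesis
      unfolding sum_distrib_left by (simp only: sign ac_simps)
  qed
  also note *
  finally show ?thesis
    by (simp add: h_def b_powi algebra_simps)
qed

lemma fib_like_sum_ascending:
  assumes "F (k + t) \<noteq> 0 \<or> n \<le> r"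
  shows "(-1) powi t * F k * (\<Sum>j=0..n. F (k + t) powi (r - j) * F t powi j * G (s * (r + 1) - t + k * j))
    = F (k + t) powi (r + 1) * G (s * (r + 1))
      - F (k + t) powi (r - n) * F t powi (n + 1) * G (s * (r + 1) + k * (n + 1))"
proof -
  \<comment> \<open>The two weights exchange their roles, which reverses the sign of the telescoping
    difference; the progression is shifted by one step to match.\<close>
  define h where "h j = G (s * (r + 1) + k * (j + 1))" for j
  have "- ((-1) powi t * F k) * G (s * (r + 1) - t + k * j) = F t * h j - F (k + t) * h (j - 1)" for j
    using fib_like_three_term[OF G, of t k "s * (r + 1) + k * j"]
    by (simp add: h_def algebra_simps)
  from weighted_telescoping[where h = h, OF n assms this] show ?thesis
    by (simp add: h_def algebra_simps)
qed

end

theorem theorem6: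
  fixes r n s k t :: int
  assumes "n \<ge> 0"
  shows
    "(F t \<noteq> 0 \<or> n \<le> r \<longrightarrow>
        (-1) powi t * F k * (\<Sum>j=0..n. F (k + t) powi j * F t powi (r - j) * F (r * (s + k) + s - t - k * j))
          = F t powi (r - n) * F (k + t) powi (n + 1) * F (s * (r + 1) + k * (r - n))
            - F t powi (r + 1) * F ((s + k) * (r + 1)))
     \<and>
     (F t \<noteq> 0 \<or> n \<le> r \<longrightarrow>
        (-1) powi t * F k * (\<Sum>j=0..n. F (k + t) powi j * F t powi (r - j) * L (r * (s + k) + s - t - k * j))
          = F t powi (r - n) * F (k + t) powi (n + 1) * L (s * (r + 1) + k * (r - n))
            - F t powi (r + 1) * L ((s + k) * (r + 1)))
     \<and>
     (F k \<noteq> 0 \<or> n \<le> r \<longrightarrow>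
        (-1) powi (r * t) * F t * (\<Sum>j=0..n. (-1) powi (t * j) * F k powi (r - j) * F (k + t) powi j * F (r * (s - t) + s + k + t * j))
          = (-1) powi (t * (r - n)) * F k powi (r - n) * F (k + t) powi (n + 1) * F (r * (s - t) + t * n + s)
            - (-1) powi (t * (r + 1)) * F k powi (r + 1) * F ((s - t) * (r + 1)))
     \<and>
     (F k \<noteq> 0 \<or> n \<le> r \<longrightarrow>
        (-1) powi (r * t) * F t * (\<Sum>j=0..n. (-1) powi (t * j) * F k powi (r - j) * F (k + t) powi j * L (r * (s - t) + s + k + t * j))
          = (-1) powi (t * (r - n)) * F k powi (r - n) * F (k + t) powi (n + 1) * L (r * (s - t) + t * n + s)
            - (-1) powi (t * (r + 1)) * F k powi (r + 1) * L ((s - t) * (r + 1)))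
     \<and>
     (F (k + t) \<noteq> 0 \<or> n \<le> r \<longrightarrow>
        (-1) powi t * F k * (\<Sum>j=0..n. F (k + t) powi (r - j) * F t powi j * F (s * (r + 1) - t + k * j))
          = F (k + t) powi (r + 1) * F (s * (r + 1))
            - F (k + t) powi (r - n) * F t powi (n + 1) * F (s * (r + 1) + k * (n + 1)))
     \<and>
     (F (k + t) \<noteq> 0 \<or> n \<le> r \<longrightarrow>
        (-1) powi t * F k * (\<Sum>j=0..n. F (k + t) powi (r - j) * F t powi j * L (s * (r + 1) - t + k * j))
          = F (k + t) powi (r + 1) * L (s * (r + 1))
            - F (k + t) powi (r - n) * F t powi (n + 1) * L (s * (r + 1) + k * (n + 1)))"
  apply (intro conjI impI)
  subgoal by (rule fib_like_sum_descending[OF fib_like_F assms])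
  subgoal by (rule fib_like_sum_descending[OF fib_like_L assms])
  subgoal by (rule fib_like_sum_alternating[OF fib_like_F assms])
  subgoal by (rule fib_like_sum_alternating[OF fib_like_L assms])
  subgoal by (rule fib_like_sum_ascending[OF fib_like_F assms])
  subgoal by (rule fib_like_sum_ascending[OF fib_like_L assms])
  done

end
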